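(* Let $X$ be an almost isometric ideal in a Banach space $Y$. If $Y$ has the strong diameter 2 property, then so does $X$.
   Context: All Banach spaces are real. For a Banach space $Z$ with closed unit ball $B_Z$, a slice of $B_Z$ is a set $S(z^{*},\varepsilon)=\{z\in B_Z: z^{*}(z)>1-\varepsilon\}$, where $z^{*}\in Z^{*}$, $\|z^{*}\|=1$ and $\varepsilon>0$. A finite convex combination of slices of $B_Z$ is a set of the form $\sum_{i=1}^{n}\lambda_i S(z_i^{*},\varepsilon_i)$ (Minkowski sum) with $\lambda_i\ge 0$, $\sum_{i=1}^{n}\lambda_i=1$, $\|z_i^{*}\|=1$ and $\varepsilon_i>0$. $Z$ has the strong diameter 2 property if every finite convex combination of slices of $B_Z$ has diameter 2. (In the claim $X$ is itself regarded as a Banach space.) A subspace $X$ of a Banach space $Y$ is an almost isometric ideal (ai-ideal) in $Y$ if for every $\varepsilon>0$ and every finite-dimensional subspace $E\subset Y$ there exists a linear operator $T:E\to X$ such that $Te=e$ for all $e\in X\cap E$ and $(1+\varepsilon)^{-1}\|e\|\le\|Te\|\le(1+\varepsilon)\|e\|$ for all $e\in E$. *)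

theory Defs
  imports "HOL-Analysis.Analysis"
begin

text \<open>
  A Banach space is given here as a closed linear subspace \<open>Z\<close> of an ambient Banach space (possibly
  \<open>Z = UNIV\<close>). Linear maps defined on \<open>Z\<close> are represented by total functions whose values outside
  \<open>Z\<close> are irrelevant, so linearity, boundedness and norms only refer to points of \<open>Z\<close>.
\<close>

definition linear_on_subspace ::
    "'a::real_vector set \<Rightarrow> ('a \<Rightarrow> 'b::real_vector) \<Rightarrow> bool" where
  "linear_on_subspace Z f \<longleftrightarrow>
     (\<forall>x\<in>Z. \<forall>y\<in>Z. f (x + y) = f x + f y) \<and>
     (\<forall>c. \<forall>x\<in>Z. f (c *\<^sub>R x) = c *\<^sub>R f x)"

definition dual_of :: "'a::real_normed_vector set \<Rightarrow> ('a \<Rightarrow> real) set" where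
  "dual_of Z = {f. linear_on_subspace Z f \<and> (\<exists>K. \<forall>z\<in>Z. \<bar>f z\<bar> \<le> K * norm z)}"

definition unit_ball_of :: "'a::real_normed_vector set \<Rightarrow> 'a set" where
  "unit_ball_of Z = {z \<in> Z. norm z \<le> 1}"

text \<open>The supremum below is that of a bounded nonempty set whenever \<open>Z\<close> is a subspace and
  \<open>f \<in> dual_of Z\<close>.\<close>

definition dual_norm :: "'a::real_normed_vector set \<Rightarrow> ('a \<Rightarrow> real) \<Rightarrow> real" where
  "dual_norm Z f = (SUP z\<in>unit_ball_of Z. \<bar>f z\<bar>)"

definition slice_of ::
    "'a::real_normed_vector set \<Rightarrow> ('a \<Rightarrow> real) \<Rightarrow> real \<Rightarrow> 'a set" where
  "slice_of Z f e = {z \<in> unit_ball_of Z. f z > 1 - e}"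

definition is_slice :: "'a::real_normed_vector set \<Rightarrow> 'a set \<Rightarrow> bool" where
  "is_slice Z S \<longleftrightarrow>
     (\<exists>f e. f \<in> dual_of Z \<and> dual_norm Z f = 1 \<and> e > 0 \<and> S = slice_of Z f e)"

definition minkowski_combination ::
    "nat \<Rightarrow> (nat \<Rightarrow> real) \<Rightarrow> (nat \<Rightarrow> 'a::real_vector set) \<Rightarrow> 'a set" where
  "minkowski_combination n l S = {(\<Sum>i<n. l i *\<^sub>R x i) | x. \<forall>i<n. x i \<in> S i}"

definition strong_diameter_2_property :: "'a::real_normed_vector set \<Rightarrow> bool" where
  "strong_diameter_2_property Z \<longleftrightarrow>
     (\<forall>n l S. (\<forall>i<n. l i \<ge> 0) \<and> (\<Sum>i<n. l i) = 1 \<and> (\<forall>i<n. is_slice Z (S i)) \<longrightarrow>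
        diameter (minkowski_combination n l S) = 2)"

text \<open>Finite-dimensionality is expressed by a finite spanning set because \<open>dim E = 0\<close> for
  infinite-dimensional \<open>E\<close>.\<close>

definition finite_dimensional_subspace :: "'a::real_vector set \<Rightarrow> bool" where
  "finite_dimensional_subspace E \<longleftrightarrow> (\<exists>B. finite B \<and> E = span B)"

definition ai_ideal :: "'a::real_normed_vector set \<Rightarrow> 'a set \<Rightarrow> bool" where
  "ai_ideal X Y \<longleftrightarrow>
     subspace X \<and> X \<subseteq> Y \<and>
     (\<forall>e>0. \<forall>E. finite_dimensional_subspace E \<and> E \<subseteq> Y \<longrightarrow>
        (\<exists>T :: 'a \<Rightarrow> 'a. linear_on_subspace E T \<and> T ` E \<subseteq> X \<and>
           (\<forall>x\<in>X \<inter> E. T x = x) \<and>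
           (\<forall>x\<in>E. inverse (1 + e) * norm x \<le> norm (T x) \<and>
                  norm (T x) \<le> (1 + e) * norm x)))"

end

theory Submission
  imports Defs
begin

text \<open>
  Let \<open>Y\<close> be the whole space. The ai-ideal condition provides, for finite-dimensional \<open>E\<close> and
  \<open>\<epsilon> > 0\<close>, operators \<open>T : E \<rightarrow> X\<close> that fix \<open>X \<inter> E\<close> and distort norms by at most \<open>1 + \<epsilon>\<close>. Every
  vector eventually belongs to \<open>E\<close> along the directed set of pairs \<open>(E, \<epsilon>)\<close>. For \<open>f\<close> in the dual
  of \<open>X\<close> and \<open>y \<in> Y\<close> the numbers \<open>f (T y)\<close> stay bounded along this net, so by Tychonoff's theorem
  some finer filter makes all of them converge at once
  (\<open>pointwise_convergent_subfilter\<close>). The limits \<open>\<phi> f y = lim f (T y)\<close> are linear in \<open>y\<close>, extend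
  \<open>f\<close> and satisfy \<open>\<parallel>\<phi> f\<parallel> = \<parallel>f\<parallel>\<close> (\<open>ai_ideal_dual_extension\<close>).

  A convex combination of slices of the ball of \<open>X\<close> given by functionals \<open>f\<^sub>i\<close> is thus accompanied by
  the combination of slices of the ball of \<open>Y\<close> given by \<open>\<phi> f\<^sub>i\<close>, with the same widths. By hypothesis
  the latter contains points \<open>\<Sum> \<lambda>\<^sub>i y\<^sub>i\<close> and \<open>\<Sum> \<lambda>\<^sub>i z\<^sub>i\<close> whose distance is as close to \<open>2\<close> as
  desired. The vectors \<open>T y\<^sub>i / (1 + \<epsilon>)\<close> and \<open>T z\<^sub>i / (1 + \<epsilon>)\<close> lie in the ball of \<open>X\<close>. Since
  \<open>f\<^sub>i (T y\<^sub>i) / (1 + \<epsilon>) \<rightarrow> \<phi> f\<^sub>i y\<^sub>i\<close> and slices are given by a strict inequality, they eventually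
  lie in the slices of \<open>f\<^sub>i\<close> (\<open>eventually_slice_of\<close>). As \<open>T\<close> is linear and shrinks norms by a factor
  of at most \<open>1 + \<epsilon>\<close>, the two combinations lose only a factor \<open>(1 + \<epsilon>)\<^sup>2\<close> of their
  distance, which tends to \<open>1\<close>.
\<close>

section \<open>Simultaneous convergence along a finer filter\<close>

text \<open>
  A cluster point \<open>h\<close> of \<open>g\<close> exists in the compact product of the intervals \<open>[-C k, C k]\<close>, and the
  filter generated by \<open>F\<close> and the preimages of neighbourhoods of \<open>h\<close> makes \<open>g\<close> converge to it.
  This replaces the usual choice of an ultrafilter.
\<close>

lemma pointwise_convergent_subfilter:
  fixes g :: "'i \<Rightarrow> 'k \<Rightarrow> real"
  assumes F: "F \<noteq> bot"
    and bounded: "\<And>k. \<forall>\<^sub>F a in F. \<bar>g a k\<bar> \<le> C k"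
  obtains G h where "G \<le> F" "G \<noteq> bot" "\<And>k. ((\<lambda>a. g a k) \<longlongrightarrow> h k) G"
proof -
  \<comment> \<open>The bound holds only eventually, from a stage that may depend on \<open>k\<close>, so \<open>g\<close> need not
    eventually lie in the product of the intervals; after truncation it always does.\<close>
  define g' where "g' a k = (if \<bar>g a k\<bar> \<le> C k then g a k else 0)" for a k
  define K where "K = (\<Pi>\<^sub>E k\<in>UNIV. {- \<bar>C k\<bar>..\<bar>C k\<bar>})"
  have "compactin (product_topology (\<lambda>_. euclidean) UNIV) K"
    unfolding K_def compactin_PiE by (simp add: compactin_euclidean_iff)
  then have "compact K"
    by (simp add: euclidean_product_topology)
  moreover have "\<forall>\<^sub>F x in filtermap g' F. x \<in> K"
    by (auto simp: eventually_filtermap K_def g'_def intro!: always_eventually)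
  moreover have "filtermap g' F \<noteq> bot"
    using F by (simp add: filtermap_bot_iff)
  ultimately obtain h where h: "inf (nhds h) (filtermap g' F) \<noteq> bot"
    unfolding compact_filter by blast
  define G where "G = inf (filtercomap g' (nhds h)) F"
  have GF: "G \<le> F" by (simp add: G_def)
  have nb: "G \<noteq> bot"
  proof
    assume "G = bot"
    then have "filtermap g' G = bot" by (simp add: filtermap_bot_iff)
    moreover have "inf (nhds h) (filtermap g' F) \<le> filtermap g' G"
    proof (rule filter_leI)
      fix P assume "eventually P (filtermap g' G)"
      then have "eventually (\<lambda>a. P (g' a)) G" by (simp add: eventually_filtermap)
      then obtain Q R where QR: "eventually Q (filtercomap g' (nhds h))" "eventually R F"
        "\<And>a. Q a \<Longrightarrow> R a \<Longrightarrow> P (g' a)"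
        unfolding G_def eventually_inf by blast
      then obtain Q' where Q': "eventually Q' (nhds h)" "\<And>a. Q' (g' a) \<Longrightarrow> Q a"
        unfolding eventually_filtercomap by blast
      have "eventually (\<lambda>x. Q' x \<longrightarrow> P x) (filtermap g' F)"
        using QR(2) unfolding eventually_filtermap
        by (rule eventually_mono) (use QR(3) Q'(2) in blast)
      with Q'(1) show "eventually P (inf (nhds h) (filtermap g' F))"
        unfolding eventually_inf by blast
    qed
    ultimately show False using h by (simp add: bot_unique)
  qed
  have lim: "filterlim g' (nhds h) G"
    unfolding G_def filterlim_iff_le_filtercomap by simp
  have lim': "((\<lambda>a. g' a k) \<longlongrightarrow> h k) G" for k
  proof (rule topological_tendstoI)
    fix U assume U: "open U" "h k \<in> U"
    have "open ((\<lambda>x. x k) -` U)"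
      using U(1) continuous_on_product_coordinates by (rule open_vimage)
    then show "\<forall>\<^sub>F a in G. g' a k \<in> U"
      using topological_tendstoD[OF lim, of "(\<lambda>x. x k) -` U"] U(2) by simp
  qed
  have "((\<lambda>a. g a k) \<longlongrightarrow> h k) G" for k
  proof -
    have "\<forall>\<^sub>F a in G. g' a k = g a k"
      using filter_leD[OF GF bounded[of k]] by eventually_elim (simp add: g'_def)
    with lim'[of k] show ?thesis by (simp add: tendsto_cong)
  qed
  with GF nb show thesis by (rule that)
qed

section \<open>The net of almost isometric operators into an ai-ideal\<close>

definition almost_isometric_retraction ::
    "'a::real_normed_vector set \<Rightarrow> 'a set \<Rightarrow> real \<Rightarrow> ('a \<Rightarrow> 'a) \<Rightarrow> bool" where
  "almost_isometric_retraction X E e T \<longleftrightarrow>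
     linear_on_subspace E T \<and> T ` E \<subseteq> X \<and> (\<forall>x\<in>X \<inter> E. T x = x) \<and>
     (\<forall>x\<in>E. inverse (1 + e) * norm x \<le> norm (T x) \<and> norm (T x) \<le> (1 + e) * norm x)"

lemma almost_isometric_retraction_subset:
  assumes "almost_isometric_retraction X E e T" and "D \<subseteq> E"
  shows "almost_isometric_retraction X D e T"
  using assms unfolding almost_isometric_retraction_def linear_on_subspace_def by blast

lemma linear_on_subspace_diff:
  assumes "subspace Z" "linear_on_subspace Z f" "x \<in> Z" "y \<in> Z"
  shows "f (x - y) = f x - f y"
proof -
  have "- y \<in> Z" using assms subspace_neg by blast
  moreover have "f (-1 *\<^sub>R y) = -1 *\<^sub>R f y"
    using assms unfolding linear_on_subspace_def by blast
  ultimately show ?thesis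
    using assms unfolding linear_on_subspace_def
    by (metis diff_conv_add_uminus scaleR_minus1_left)
qed

lemma linear_on_subspace_sum:
  assumes "subspace Z" "linear_on_subspace Z f" "\<And>i. i \<in> I \<Longrightarrow> x i \<in> Z"
  shows "f (\<Sum>i\<in>I. l i *\<^sub>R x i) = (\<Sum>i\<in>I. l i *\<^sub>R f (x i))"
  using assms(3)
proof (induction I rule: infinite_finite_induct)
  case (insert j I)
  have "(\<Sum>i\<in>I. l i *\<^sub>R x i) \<in> Z" "l j *\<^sub>R x j \<in> Z"
    using insert assms(1) by (auto intro!: subspace_sum subspace_scale)
  with insert show ?case
    using assms(2) by (simp add: linear_on_subspace_def)
qed (use linear_on_subspace_diff[OF assms(1,2), of 0 0] subspace_0[OF assms(1)] in auto)

text \<open>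
  The net is indexed by a finite set \<open>A\<close> and a number \<open>n\<close>, standing for \<open>E = span A\<close> and
  \<open>\<epsilon> = 1/(n + 1)\<close>; along the product filter \<open>A\<close> eventually contains any given finite set.
\<close>

lemma ai_ideal_net:
  fixes X :: "'a::real_normed_vector set"
  assumes "ai_ideal X UNIV"
  obtains F :: "('a set \<times> nat) filter" and e T
  where "F \<noteq> bot" "(e \<longlongrightarrow> 0) F" "\<And>a. e a > 0"
    "\<And>B. finite B \<Longrightarrow> \<forall>\<^sub>F a in F. almost_isometric_retraction X (span B) (e a) (T a)"
proof -
  define e :: "'a set \<times> nat \<Rightarrow> real" where "e a = inverse (real (Suc (snd a)))" for a
  have e_pos: "e a > 0" for a by (simp add: e_def)
  have "\<exists>T. almost_isometric_retraction X (span (fst a)) (e a) T" if "finite (fst a)" for a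
  proof -
    have "finite_dimensional_subspace (span (fst a))"
      using that by (auto simp: finite_dimensional_subspace_def)
    then show ?thesis
      using assms e_pos[of a] by (simp add: ai_ideal_def almost_isometric_retraction_def)
  qed
  then obtain T where T:
    "\<And>a. finite (fst a) \<Longrightarrow> almost_isometric_retraction X (span (fst a)) (e a) (T a)"
    by metis
  let ?F = "finite_subsets_at_top (UNIV :: 'a set) \<times>\<^sub>F (sequentially :: nat filter)"
  have "?F \<noteq> bot"
    by (simp add: prod_filter_eq_bot)
  moreover have "(e \<longlongrightarrow> 0) ?F"
    unfolding e_def
    by (rule filterlim_compose[OF LIMSEQ_inverse_real_of_nat filterlim_snd])
  moreover have "\<forall>\<^sub>F a in ?F. almost_isometric_retraction X (span B) (e a) (T a)"
    if "finite B" for B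
  proof -
    have "\<forall>\<^sub>F A in finite_subsets_at_top UNIV. finite A \<and> B \<subseteq> A"
      using that unfolding eventually_finite_subsets_at_top by auto
    then have "\<forall>\<^sub>F a in ?F. finite (fst a) \<and> B \<subseteq> fst a"
      by (rule eventually_compose_filterlim[OF _ filterlim_fst])
    then show ?thesis
      by eventually_elim (meson T almost_isometric_retraction_subset span_mono)
  qed
  ultimately show thesis using e_pos that by blast
qed

section \<open>Norms of functionals\<close>

lemma bdd_above_dual_norm:
  assumes "f \<in> dual_of X"
  shows "bdd_above ((\<lambda>z. \<bar>f z\<bar>) ` unit_ball_of X)"
proof -
  obtain K where K: "\<And>z. z \<in> X \<Longrightarrow> \<bar>f z\<bar> \<le> K * norm z"
    using assms by (auto simp: dual_of_def)
  have "\<bar>f z\<bar> \<le> \<bar>K\<bar>" if "z \<in> unit_ball_of X" for z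
  proof -
    have "\<bar>f z\<bar> \<le> K * norm z" using K that by (auto simp: unit_ball_of_def)
    also have "\<dots> \<le> \<bar>K\<bar> * 1"
      using that by (intro mult_mono) (auto simp: unit_ball_of_def)
    finally show ?thesis by simp
  qed
  then show ?thesis by (auto intro!: bdd_aboveI)
qed

lemma dual_norm_nonneg:
  assumes "subspace X" and "f \<in> dual_of X"
  shows "0 \<le> dual_norm X f"
proof -
  have "0 \<in> unit_ball_of X"
    using assms(1) by (simp add: unit_ball_of_def subspace_0)
  then have "\<bar>f 0\<bar> \<le> dual_norm X f"
    unfolding dual_norm_def by (rule cSUP_upper[OF _ bdd_above_dual_norm[OF assms(2)]])
  then show ?thesis by linarith
qed

lemma dual_norm_bound:
  assumes X: "subspace X" and f: "f \<in> dual_of X" and x: "x \<in> X"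
  shows "\<bar>f x\<bar> \<le> dual_norm X f * norm x"
proof (cases "x = 0")
  case True
  then show ?thesis
    using linear_on_subspace_diff[OF X, of f x x] f x by (auto simp: dual_of_def)
next
  case False
  let ?z = "inverse (norm x) *\<^sub>R x"
  have "?z \<in> unit_ball_of X"
    using False x X by (simp add: unit_ball_of_def subspace_scale)
  then have "\<bar>f ?z\<bar> \<le> dual_norm X f"
    unfolding dual_norm_def by (rule cSUP_upper[OF _ bdd_above_dual_norm[OF f]])
  moreover have "f ?z = inverse (norm x) * f x"
    using f x by (auto simp: dual_of_def linear_on_subspace_def)
  ultimately have "inverse (norm x) * \<bar>f x\<bar> \<le> dual_norm X f"
    by (simp add: abs_mult)
  then show ?thesis
    using False by (simp add: field_simps)
qed

lemma dual_norm_extension: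
  assumes X: "subspace X" and f: "f \<in> dual_of X"
    and g: "linear_on_subspace UNIV g"
    and ext: "\<And>x. x \<in> X \<Longrightarrow> g x = f x"
    and bound: "\<And>y. \<bar>g y\<bar> \<le> dual_norm X f * norm y"
  shows "g \<in> dual_of UNIV" and "dual_norm UNIV g = dual_norm X f"
proof -
  show g': "g \<in> dual_of UNIV" using g bound by (auto simp: dual_of_def)
  have zero: "0 \<in> unit_ball_of X"
    using X by (simp add: unit_ball_of_def subspace_0)
  have sub: "unit_ball_of X \<subseteq> unit_ball_of UNIV"
    by (auto simp: unit_ball_of_def)
  show "dual_norm UNIV g = dual_norm X f"
  proof (rule antisym)
    have "\<bar>g y\<bar> \<le> dual_norm X f" if "y \<in> unit_ball_of UNIV" for y
      using bound[of y] that mult_left_le[OF _ dual_norm_nonneg[OF X f], of "norm y"]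
      by (simp add: unit_ball_of_def)
    then show "dual_norm UNIV g \<le> dual_norm X f"
      unfolding dual_norm_def[of UNIV] using zero sub by (intro cSUP_least) auto
    have "\<bar>f x\<bar> \<le> dual_norm UNIV g" if "x \<in> unit_ball_of X" for x
    proof -
      have "\<bar>g x\<bar> \<le> dual_norm UNIV g"
        unfolding dual_norm_def[of UNIV] using that sub
        by (intro cSUP_upper[OF _ bdd_above_dual_norm[OF g']]) auto
      then show ?thesis using ext that by (simp add: unit_ball_of_def)
    qed
    then show "dual_norm X f \<le> dual_norm UNIV g"
      unfolding dual_norm_def[of X] using zero by (intro cSUP_least) auto
  qed
qed

section \<open>Norm-preserving extension of functionals from an ai-ideal\<close>

text \<open>
  The algebraic and metric properties of \<open>\<phi> f\<close> are limits of those of \<open>f \<circ> T a\<close>, each of which holds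
  eventually because it involves only finitely many vectors. A plain Hahn-Banach extension would
  not do: what ties \<open>\<phi> f\<close> to the operators is the convergence \<open>f (T a y) \<rightarrow> \<phi> f y\<close>, along one filter
  that serves all functionals.
\<close>

lemma ai_ideal_dual_extension:
  fixes X :: "'a::real_normed_vector set"
  assumes ai: "ai_ideal X UNIV"
  obtains G :: "('a set \<times> nat) filter" and e T \<phi>
  where "G \<noteq> bot" "(e \<longlongrightarrow> 0) G" "\<And>a. e a > 0"
    "\<And>B. finite B \<Longrightarrow> \<forall>\<^sub>F a in G. almost_isometric_retraction X (span B) (e a) (T a)"
    "\<And>f. f \<in> dual_of X \<Longrightarrow> \<phi> f \<in> dual_of UNIV"
    "\<And>f. f \<in> dual_of X \<Longrightarrow> dual_norm UNIV (\<phi> f) = dual_norm X f"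
    "\<And>f y. f \<in> dual_of X \<Longrightarrow> ((\<lambda>a. f (T a y)) \<longlongrightarrow> \<phi> f y) G"
proof -
  have X: "subspace X" using ai by (simp add: ai_ideal_def)
  obtain F :: "('a set \<times> nat) filter" and e T where F: "F \<noteq> bot" "(e \<longlongrightarrow> 0) F"
    and e: "\<And>a. e a > 0"
    and T: "\<And>B. finite B \<Longrightarrow> \<forall>\<^sub>F a in F. almost_isometric_retraction X (span B) (e a) (T a)"
    using ai_ideal_net[OF ai] by metis
  have ev_bound: "\<forall>\<^sub>F a in F. \<bar>f (T a y)\<bar> \<le> \<bar>dual_norm X f\<bar> * ((1 + e a) * norm y)"
    if f: "f \<in> dual_of X" for f y
    using T[of "{y}", simplified]
  proof eventually_elim
    case (elim a)
    have y: "y \<in> span {y}" by (simp add: span_base)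
    then have "T a y \<in> X" and le: "norm (T a y) \<le> (1 + e a) * norm y"
      using elim by (auto simp: almost_isometric_retraction_def)
    then have "\<bar>f (T a y)\<bar> \<le> dual_norm X f * norm (T a y)"
      using dual_norm_bound[OF X f] by blast
    also have "\<dots> \<le> \<bar>dual_norm X f\<bar> * ((1 + e a) * norm y)"
      using le by (intro mult_mono) auto
    finally show ?case .
  qed
  \<comment> \<open>Indexing by pairs \<open>(f, y)\<close> yields a single filter for all functionals. The value \<open>0\<close> off the
    dual of \<open>X\<close> keeps every coordinate bounded.\<close>
  define g where "g a k = (if fst k \<in> dual_of X then fst k (T a (snd k)) else 0)"
    for a and k :: "('a \<Rightarrow> real) \<times> 'a"
  have g_bound: "\<forall>\<^sub>F a in F. \<bar>g a k\<bar> \<le> \<bar>dual_norm X (fst k)\<bar> * (2 * norm (snd k))" for k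
  proof (cases "fst k \<in> dual_of X")
    case True
    have "\<forall>\<^sub>F a in F. e a < 1" using F(2) by (rule order_tendstoD) simp
    with ev_bound[OF True, of "snd k"] show ?thesis
    proof eventually_elim
      case (elim a)
      have "(1 + e a) * norm (snd k) \<le> 2 * norm (snd k)"
        using elim by (intro mult_right_mono) auto
      then have "\<bar>dual_norm X (fst k)\<bar> * ((1 + e a) * norm (snd k))
          \<le> \<bar>dual_norm X (fst k)\<bar> * (2 * norm (snd k))"
        by (intro mult_left_mono) auto
      with elim True show ?case by (simp add: g_def)
    qed
  qed (simp add: g_def)
  obtain G h where GF: "G \<le> F" and G: "G \<noteq> bot"
    and h: "\<And>k. ((\<lambda>a. g a k) \<longlongrightarrow> h k) G"
    using pointwise_convergent_subfilter[where g = g, OF F(1) g_bound] by blast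
  define \<phi> where "\<phi> f y = h (f, y)" for f y
  have lim: "((\<lambda>a. f (T a y)) \<longlongrightarrow> \<phi> f y) G" if "f \<in> dual_of X" for f y
    using h[of "(f, y)"] that by (simp add: g_def \<phi>_def)
  have e0: "(e \<longlongrightarrow> 0) G" using F(2) GF by (rule tendsto_mono[rotated])
  have TG: "\<forall>\<^sub>F a in G. almost_isometric_retraction X (span B) (e a) (T a)" if "finite B" for B
    using T[OF that] GF by (rule filter_leD[rotated])
  have "\<phi> f \<in> dual_of UNIV \<and> dual_norm UNIV (\<phi> f) = dual_norm X f" if f: "f \<in> dual_of X" for f
  proof -
    have flin: "linear_on_subspace X f" using f by (simp add: dual_of_def)
    have add: "\<phi> f (x + y) = \<phi> f x + \<phi> f y" for x y
    proof (rule tendsto_unique[OF G lim[OF f]])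
      have "\<forall>\<^sub>F a in G. f (T a x) + f (T a y) = f (T a (x + y))"
        using TG[of "{x, y}", simplified]
      proof eventually_elim
        case (elim a)
        have "x \<in> span {x, y}" "y \<in> span {x, y}" by (auto simp: span_base)
        with elim flin show ?case
          by (auto simp: almost_isometric_retraction_def linear_on_subspace_def image_subset_iff)
      qed
      then show "((\<lambda>a. f (T a (x + y))) \<longlongrightarrow> \<phi> f x + \<phi> f y) G"
        by (rule Lim_transform_eventually[OF tendsto_add[OF lim[OF f] lim[OF f]]])
    qed
    have scale: "\<phi> f (c *\<^sub>R x) = c * \<phi> f x" for c x
    proof (rule tendsto_unique[OF G lim[OF f]])
      have "\<forall>\<^sub>F a in G. c * f (T a x) = f (T a (c *\<^sub>R x))"
        using TG[of "{x}", simplified]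
      proof eventually_elim
        case (elim a)
        have "x \<in> span {x}" by (auto simp: span_base)
        with elim flin show ?case
          by (auto simp: almost_isometric_retraction_def linear_on_subspace_def image_subset_iff)
      qed
      then show "((\<lambda>a. f (T a (c *\<^sub>R x))) \<longlongrightarrow> c * \<phi> f x) G"
        by (rule Lim_transform_eventually[OF tendsto_mult_left[OF lim[OF f]]])
    qed
    have ext: "\<phi> f x = f x" if x: "x \<in> X" for x
    proof (rule tendsto_unique[OF G lim[OF f]])
      have "\<forall>\<^sub>F a in G. f x = f (T a x)"
        using TG[of "{x}", simplified]
        by eventually_elim (use x in \<open>auto simp: almost_isometric_retraction_def span_base\<close>)
      then show "((\<lambda>a. f (T a x)) \<longlongrightarrow> f x) G"
        by (rule Lim_transform_eventually[OF tendsto_const])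
    qed
    have bound: "\<bar>\<phi> f y\<bar> \<le> dual_norm X f * norm y" for y
    proof (rule tendsto_le[OF G])
      show "((\<lambda>a. \<bar>f (T a y)\<bar>) \<longlongrightarrow> \<bar>\<phi> f y\<bar>) G" by (rule tendsto_rabs[OF lim[OF f]])
      have "((\<lambda>a. \<bar>dual_norm X f\<bar> * ((1 + e a) * norm y)) \<longlongrightarrow>
          \<bar>dual_norm X f\<bar> * ((1 + 0) * norm y)) G"
        by (intro tendsto_intros e0)
      then show "((\<lambda>a. \<bar>dual_norm X f\<bar> * ((1 + e a) * norm y)) \<longlongrightarrow> dual_norm X f * norm y) G"
        using dual_norm_nonneg[OF X f] by simp
      show "\<forall>\<^sub>F a in G. \<bar>f (T a y)\<bar> \<le> \<bar>dual_norm X f\<bar> * ((1 + e a) * norm y)"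
        using ev_bound[OF f] GF by (rule filter_leD[rotated])
    qed
    show ?thesis
      using dual_norm_extension[OF X f _ ext bound] add scale by (simp add: linear_on_subspace_def)
  qed
  with G e0 e TG lim that show thesis by blast
qed

section \<open>Transfer of slices and the strong diameter 2 property\<close>

text \<open>
  Dividing by \<open>1 + e a\<close> brings \<open>T a y\<close> back into the unit ball. The factor tends to \<open>1\<close>, so it does not
  affect the limit of the values of \<open>f\<close>, and the inequality defining the slice is open.
\<close>

lemma eventually_slice_of:
  assumes "subspace X" and f: "f \<in> dual_of X"
    and e: "(e \<longlongrightarrow> 0) G" "\<And>a. e a > 0"
    and T: "\<forall>\<^sub>F a in G. almost_isometric_retraction X (span {y}) (e a) (T a)"
    and lim: "((\<lambda>a. f (T a y)) \<longlongrightarrow> g y) G"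
    and y: "y \<in> slice_of UNIV g d"
  shows "\<forall>\<^sub>F a in G. inverse (1 + e a) *\<^sub>R T a y \<in> slice_of X f d"
proof -
  have "((\<lambda>a. inverse (1 + e a) * f (T a y)) \<longlongrightarrow> inverse (1 + 0) * g y) G"
    by (intro tendsto_intros e lim) simp
  moreover have "1 - d < inverse (1 + 0) * g y"
    using y by (simp add: slice_of_def)
  ultimately have "\<forall>\<^sub>F a in G. 1 - d < inverse (1 + e a) * f (T a y)"
    by (rule order_tendstoD)
  with T show ?thesis
  proof eventually_elim
    case (elim a)
    have "y \<in> span {y}" by (simp add: span_base)
    then have TX: "T a y \<in> X" and le: "norm (T a y) \<le> (1 + e a) * norm y"
      using elim by (auto simp: almost_isometric_retraction_def)
    have "norm (T a y) \<le> (1 + e a) * 1"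
      using y e(2)[of a] by (intro order_trans[OF le] mult_left_mono)
        (auto simp: slice_of_def unit_ball_of_def)
    then have "norm (inverse (1 + e a) *\<^sub>R T a y) \<le> 1"
      using e(2)[of a] by (simp add: field_simps)
    moreover have "f (inverse (1 + e a) *\<^sub>R T a y) = inverse (1 + e a) * f (T a y)"
      using f TX by (simp add: dual_of_def linear_on_subspace_def)
    ultimately show ?case
      using elim TX \<open>subspace X\<close> by (simp add: slice_of_def unit_ball_of_def subspace_scale)
  qed
qed

lemma norm_minkowski_combination_le:
  assumes l: "\<forall>i<n. l i \<ge> 0" "(\<Sum>i<n. l i) = 1"
    and S: "\<And>i. i < n \<Longrightarrow> S i \<subseteq> unit_ball_of Z"
    and x: "x \<in> minkowski_combination n l S"
  shows "norm x \<le> 1"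
proof -
  obtain y where y: "x = (\<Sum>i<n. l i *\<^sub>R y i)" "\<forall>i<n. y i \<in> S i"
    using x by (auto simp: minkowski_combination_def)
  have "norm x \<le> (\<Sum>i<n. l i * 1)"
    unfolding y(1)
  proof (rule sum_norm_le)
    fix i assume "i \<in> {..<n}"
    then have "norm (y i) \<le> 1" "0 \<le> l i"
      using y(2) S l(1) by (auto simp: unit_ball_of_def)
    then show "norm (l i *\<^sub>R y i) \<le> l i * 1"
      by (simp add: mult_left_le)
  qed
  then show ?thesis using l(2) by simp
qed

lemma diameter_le_2_if_norm_le_1:
  assumes "\<And>x. x \<in> M \<Longrightarrow> norm x \<le> 1"
  shows "bounded M" and "diameter M \<le> 2"
proof -
  show "bounded M" using assms by (auto simp: bounded_iff)
  show "diameter M \<le> 2"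
  proof (rule diameter_le)
    fix x y assume "x \<in> M" "y \<in> M"
    then show "norm (x - y) \<le> 2"
      using norm_triangle_ineq4[of x y] assms[of x] assms[of y] by linarith
  qed simp
qed

theorem proposition3p3:
  fixes X :: "'a::banach set"
  assumes "closed X"
    and "ai_ideal X (UNIV :: 'a set)"
    and "strong_diameter_2_property (UNIV :: 'a set)"
  shows "strong_diameter_2_property X"
  unfolding strong_diameter_2_property_def
proof (intro allI impI, elim conjE)
  fix n :: nat and l :: "nat \<Rightarrow> real" and S :: "nat \<Rightarrow> 'a set"
  assume l: "\<forall>i<n. l i \<ge> 0" "(\<Sum>i<n. l i) = 1" and slices: "\<forall>i<n. is_slice X (S i)"
  have X: "subspace X" using assms(2) by (simp add: ai_ideal_def)
  obtain G :: "('a set \<times> nat) filter" and e T \<phi> where G: "G \<noteq> bot"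
    and e: "(e \<longlongrightarrow> 0) G" "\<And>a. e a > 0"
    and T: "\<And>B. finite B \<Longrightarrow> \<forall>\<^sub>F a in G. almost_isometric_retraction X (span B) (e a) (T a)"
    and \<phi>: "\<And>f. f \<in> dual_of X \<Longrightarrow> \<phi> f \<in> dual_of UNIV"
      "\<And>f. f \<in> dual_of X \<Longrightarrow> dual_norm UNIV (\<phi> f) = dual_norm X f"
    and lim: "\<And>f y. f \<in> dual_of X \<Longrightarrow> ((\<lambda>a. f (T a y)) \<longlongrightarrow> \<phi> f y) G"
    using ai_ideal_dual_extension[OF assms(2)] by blast
  obtain f d where f: "\<And>i. i < n \<Longrightarrow> f i \<in> dual_of X" "\<And>i. i < n \<Longrightarrow> dual_norm X (f i) = 1"
    and d: "\<And>i. i < n \<Longrightarrow> d i > 0" and S: "\<And>i. i < n \<Longrightarrow> S i = slice_of X (f i) (d i)"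
    using slices unfolding is_slice_def by metis
  define S' where "S' i = slice_of UNIV (\<phi> (f i)) (d i)" for i
  let ?M = "minkowski_combination n l S" and ?M' = "minkowski_combination n l S'"
  have M: "norm x \<le> 1" if "x \<in> ?M" for x
    using l _ that by (rule norm_minkowski_combination_le) (auto simp: S slice_of_def)
  have M': "norm x \<le> 1" if "x \<in> ?M'" for x
    using l _ that by (rule norm_minkowski_combination_le) (auto simp: S'_def slice_of_def)
  have "is_slice UNIV (S' i)" if "i < n" for i
    unfolding is_slice_def S'_def using f[OF that] d[OF that] \<phi>[of "f i"] by auto
  then have diam': "diameter ?M' = 2"
    using assms(3) l unfolding strong_diameter_2_property_def by blast
  have "2 \<le> diameter ?M"
  proof (rule dense_le_bounded)
    show "0 < (2 :: real)" by simp
    fix r :: real assume r: "0 < r" "r < 2"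
    then obtain u v where uv: "u \<in> ?M'" "v \<in> ?M'" "r < dist u v"
      using diameter_lower_bounded[of ?M' r] diameter_le_2_if_norm_le_1(1)[of ?M'] M' diam'
      by auto
    obtain y where u: "u = (\<Sum>i<n. l i *\<^sub>R y i)" and y: "\<And>i. i < n \<Longrightarrow> y i \<in> S' i"
      using uv(1) by (auto simp: minkowski_combination_def)
    obtain z where v: "v = (\<Sum>i<n. l i *\<^sub>R z i)" and z: "\<And>i. i < n \<Longrightarrow> z i \<in> S' i"
      using uv(2) by (auto simp: minkowski_combination_def)
    have slice: "\<forall>\<^sub>F a in G. inverse (1 + e a) *\<^sub>R T a w \<in> S i" if "w \<in> S' i" "i < n" for w i
      using eventually_slice_of[where g = "\<phi> (f i)" and y = w and d = "d i",
          OF X f(1) e T[of "{w}"] lim[OF f(1)]] that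
      by (simp add: S S'_def)
    have ev_y: "\<forall>\<^sub>F a in G. \<forall>i\<in>{..<n}. inverse (1 + e a) *\<^sub>R T a (y i) \<in> S i"
      and ev_z: "\<forall>\<^sub>F a in G. \<forall>i\<in>{..<n}. inverse (1 + e a) *\<^sub>R T a (z i) \<in> S i"
      using slice y z by (auto simp: eventually_ball_finite)
    define B where "B = y ` {..<n} \<union> z ` {..<n}"
    have B: "finite B" by (simp add: B_def)
    \<comment> \<open>One factor comes from the lower norm estimate of \<open>T a\<close>, the other from the normalization.\<close>
    have "((\<lambda>a. inverse (1 + e a) * (inverse (1 + e a) * norm (u - v)))
        \<longlongrightarrow> inverse (1 + 0) * (inverse (1 + 0) * norm (u - v))) G"
      by (intro tendsto_intros e) simp_all
    moreover have "r < inverse (1 + 0) * (inverse (1 + 0) * norm (u - v))"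
      using uv(3) by (simp add: dist_norm)
    ultimately have ev_r:
      "\<forall>\<^sub>F a in G. r < inverse (1 + e a) * (inverse (1 + e a) * norm (u - v))"
      by (rule order_tendstoD)
    \<comment> \<open>The statement under the quantifier does not depend on \<open>a\<close>: a single index at which all
      the conditions hold suffices, and \<open>G \<noteq> bot\<close> provides it.\<close>
    have "\<forall>\<^sub>F a in G. r \<le> diameter ?M"
      using ev_y ev_z ev_r T[OF B]
    proof eventually_elim
      case (elim a)
      have lin: "linear_on_subspace (span B) (T a)"
        and iso: "inverse (1 + e a) * norm w \<le> norm (T a w)" if "w \<in> span B" for w
        using elim that by (auto simp: almost_isometric_retraction_def)
      have yB: "y i \<in> span B" and zB: "z i \<in> span B" if "i \<in> {..<n}" for i
        using that by (auto simp: B_def intro: span_base)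
      have uB: "u \<in> span B" and vB: "v \<in> span B"
        unfolding u v using yB zB by (auto intro!: span_sum span_scale)
      let ?P = "\<lambda>w. inverse (1 + e a) *\<^sub>R T a w"
      have Pu: "?P u = (\<Sum>i<n. l i *\<^sub>R ?P (y i))"
      proof -
        have "T a u = (\<Sum>i<n. l i *\<^sub>R T a (y i))"
          unfolding u using subspace_span lin[OF uB] yB by (rule linear_on_subspace_sum)
        then show ?thesis by (simp add: scaleR_sum_right mult.commute)
      qed
      have Pv: "?P v = (\<Sum>i<n. l i *\<^sub>R ?P (z i))"
      proof -
        have "T a v = (\<Sum>i<n. l i *\<^sub>R T a (z i))"
          unfolding v using subspace_span lin[OF uB] zB by (rule linear_on_subspace_sum)
        then show ?thesis by (simp add: scaleR_sum_right mult.commute)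
      qed
      have "?P u \<in> ?M"
        unfolding minkowski_combination_def mem_Collect_eq
        by (rule exI[of _ "\<lambda>i. ?P (y i)"]) (use Pu elim in auto)
      moreover have "?P v \<in> ?M"
        unfolding minkowski_combination_def mem_Collect_eq
        by (rule exI[of _ "\<lambda>i. ?P (z i)"]) (use Pv elim in auto)
      ultimately have "dist (?P u) (?P v) \<le> diameter ?M"
        using diameter_bounded_bound[of ?M] diameter_le_2_if_norm_le_1(1)[of ?M] M by blast
      moreover have "dist (?P u) (?P v) = inverse (1 + e a) * norm (T a (u - v))"
        unfolding linear_on_subspace_diff[OF subspace_span lin[OF uB] uB vB]
        using e(2)[of a] by (simp add: dist_norm flip: scaleR_diff_right)
      moreover have "inverse (1 + e a) * (inverse (1 + e a) * norm (u - v))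
          \<le> inverse (1 + e a) * norm (T a (u - v))"
        using iso[OF span_diff[OF uB vB]] e(2)[of a] by (intro mult_left_mono) auto
      ultimately show ?case using elim(3) by linarith
    qed
    then show "r \<le> diameter ?M"
      using G by (simp add: eventually_const)
  qed
  moreover have "diameter ?M \<le> 2"
    using M by (rule diameter_le_2_if_norm_le_1(2))
  ultimately show "diameter ?M = 2" by simp
qed

end
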